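(* Let $x_0\in\mathbb{N}$ and suppose that $x_0^2+1$ has the prime factorization $$x_0^{2}+1=2^{r}p_{1}^{r_{1}}p_{2}^{r_{2}}\cdots p_{m}^{r_{m}},$$ where $m\ge 1$, $r$ is a non-negative integer, each $r_j$ is a positive integer, and $p_1<p_2<\cdots<p_m$ are odd primes. Then there exists a prime $p\equiv 1 \pmod 4$ for which $x_0$ is the Størmer number if and only if $2x_0+1\le p_m$. Moreover, if this condition is met, then $p=p_m$ (that is, $p_m$ is the prime whose Størmer number is $x_0$, so $S(p_m)=x_0$). Otherwise, $x_0$ is not the Størmer number for any prime $p\equiv 1\pmod 4$.
   Context: $\mathbb{N}$ denotes the positive integers. Let $p$ be a prime with $p\equiv 1\pmod 4$. A positive integer $x_0$ is called the Størmer number for $p$, written $S(p)=x_0$, if (i) $1<x_0\le \frac{p-1}{2}$ and (ii) $x_0^2\equiv -1 \pmod p$. (For each prime $p\equiv 1\pmod 4$ there is exactly one such $x_0$, so $S$ is a well-defined function from the set of primes congruent to $1$ modulo $4$ to $\mathbb{N}$.) *)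

theory Defs
  imports "HOL-Number_Theory.Number_Theory"
begin

text \<open>The notion is meant for primes p congruent to 1 modulo 4; for these, (p - 1) div 2 is the exact
  half of p - 1. The congruence is stated over the integers because of the negative residue.\<close>

definition is_stormer_number :: "nat \<Rightarrow> nat \<Rightarrow> bool" where
  "is_stormer_number p x \<longleftrightarrow> 1 < x \<and> x \<le> (p - 1) div 2 \<and> [(int x)\<^sup>2 = - 1] (mod int p)"

definition stormer :: "nat \<Rightarrow> nat" where
  "stormer p = (THE x. is_stormer_number p x)"

lemma is_stormer_number_unique:
  assumes p: "prime p" and x: "is_stormer_number p x" and y: "is_stormer_number p y"
  shows "x = y"
proof -
  have "[(int x)\<^sup>2 = (int y)\<^sup>2] (mod int p)"
    using x y unfolding is_stormer_number_def by (meson cong_sym cong_trans)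
  then have "int p dvd (int x - int y) * (int x + int y)"
    by (simp add: cong_iff_dvd_diff power2_eq_square algebra_simps)
  then have "int p dvd int x - int y \<or> int p dvd int x + int y"
    using p by (simp add: prime_dvd_mult_iff)
  moreover have "0 < int x + int y" "int x + int y < int p" "\<bar>int x - int y\<bar> < int p"
    using x y unfolding is_stormer_number_def by auto
  ultimately have "int x - int y = 0"
    using dvd_imp_le_int[of "int x - int y" "int p"] zdvd_not_zless[of "int x + int y" "int p"] by auto
  then show ?thesis by simp
qed

lemma ex_is_stormer_number:
  assumes p: "prime p" and p4: "[p = 1] (mod 4)"
  shows "\<exists>x. is_stormer_number p x"
proof -
  have p4': "p mod 4 = 1" using p4 by (simp add: cong_def)
  have pgt: "p > 4"
  proof -
    have "p \<noteq> 1" using p by auto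
    then show ?thesis using p4' by presburger
  qed
  define k where "k = p div 4"
  have pk: "p = 4 * k + 1" using p4' div_mult_mod_eq[of p 4] unfolding k_def by linarith
  have "[Legendre (- 1) (int p) = (- 1) ^ ((p - 1) div 2)] (mod int p)"
    using euler_criterion[of p "- 1"] p pgt by simp
  then have "[Legendre (- 1) (int p) = 1] (mod int p)"
    by (simp add: pk)
  moreover have "\<not> [- 1 = 1] (mod int p)" "\<not> [0 = 1] (mod int p)"
    using pgt by (auto simp: cong_iff_dvd_diff dest: zdvd_imp_le)
  ultimately have "QuadRes (int p) (- 1)"
    unfolding Legendre_def by (auto split: if_splits)
  then obtain z where z: "[z\<^sup>2 = - 1] (mod int p)" unfolding QuadRes_def by blast
  define a where "a = nat (z mod int p)"
  have ia: "int a = z mod int p" using pgt by (simp add: a_def)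
  have alt: "a < p" using ia pgt pos_mod_bound[of "int p" z] by linarith
  have az: "[(int a)\<^sup>2 = - 1] (mod int p)"
    using z unfolding ia cong_def by (simp add: power_mod)
  define x where "x = (if a \<le> (p - 1) div 2 then a else p - a)"
  have xz: "[(int x)\<^sup>2 = - 1] (mod int p)"
  proof (cases "a \<le> (p - 1) div 2")
    case False
    then have ix: "int x = int p - int a" using alt by (simp add: x_def)
    have "(int x)\<^sup>2 - (int a)\<^sup>2 = int p * (int p - 2 * int a)"
      unfolding ix by (simp add: power2_eq_square algebra_simps)
    then have "[(int x)\<^sup>2 = (int a)\<^sup>2] (mod int p)" by (simp add: cong_iff_dvd_diff)
    then show ?thesis using az cong_trans by blast
  qed (use az in \<open>simp add: x_def\<close>)
  have xle: "x \<le> (p - 1) div 2" using alt by (auto simp: x_def pk)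
  have dv: "int p dvd (int x)\<^sup>2 + 1" using xz by (simp add: cong_iff_dvd_diff)
  have "\<not> int p dvd 1" "\<not> int p dvd 2" using pgt by (auto dest: zdvd_imp_le)
  then have "x \<noteq> 0" "x \<noteq> 1" using dv by (auto intro: ccontr)
  then have "1 < x" by simp
  with xz xle show ?thesis unfolding is_stormer_number_def by blast
qed

lemma stormer_eq_iff:
  assumes "prime p" "[p = 1] (mod 4)"
  shows "stormer p = x \<longleftrightarrow> is_stormer_number p x"
  using ex_is_stormer_number[OF assms] is_stormer_number_unique[OF assms(1)]
  unfolding stormer_def by (metis the_equality)

end

theory Submission
  imports Defs
begin

text \<open>
  Two facts carry the proof. A prime with number \<open>x\<close> divides \<open>x\<^sup>2 + 1\<close> and is at least \<open>2 * x + 1\<close>;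
  conversely these two properties of an odd prime suffice, because a square root of \<open>- 1\<close> modulo an
  odd prime forces the prime to be \<open>1\<close> modulo \<open>4\<close>. Moreover \<open>x\<^sup>2 + 1\<close> is too small to have
  two different prime divisors of that size, since their product would also divide it. Hence the
  prime with number \<open>x\<close> is unique, and it can only be the largest odd prime divisor of
  \<open>x\<^sup>2 + 1\<close>: as soon as some odd prime divisor is at least \<open>2 * x + 1\<close>, the largest one is as well.
\<close>

lemma sqrt_minus_one_cong_iff_dvd:
  "[(int x)\<^sup>2 = - 1] (mod int p) \<longleftrightarrow> p dvd x\<^sup>2 + 1"
proof -
  have "[(int x)\<^sup>2 = - 1] (mod int p) \<longleftrightarrow> int p dvd int (x\<^sup>2 + 1)"
    by (simp add: cong_iff_dvd_diff add.commute)
  then show ?thesis by (simp only: int_dvd_int_iff)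
qed

text \<open>Euler's criterion: the root makes \<open>(- 1) ^ ((p - 1) div 2)\<close> congruent to \<open>1\<close>, so this exponent
  is even.\<close>

lemma odd_prime_dvd_square_plus_one_cong_1_mod_4:
  fixes p x :: nat
  assumes p: "prime p" "odd p" and dvd: "p dvd x\<^sup>2 + 1"
  shows "[p = 1] (mod 4)"
proof -
  have p2: "2 < p" using p prime_ge_2_nat[of p] by (cases "p = 2") auto
  have ne: "\<not> [- 1 = 0] (mod int p)" "\<not> [1 = - 1] (mod int p)"
    using p2 by (auto simp: cong_iff_dvd_diff dest: zdvd_imp_le)
  have "QuadRes (int p) (- 1)"
    using dvd unfolding QuadRes_def sqrt_minus_one_cong_iff_dvd[symmetric] by blast
  then have "Legendre (- 1) (int p) = 1"
    using ne by (simp add: Legendre_def)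
  then have "[1 = (- 1) ^ ((p - 1) div 2)] (mod int p)"
    using euler_criterion[OF p(1) p2, of "- 1"] by simp
  then have "even ((p - 1) div 2)"
    using ne(2) by (cases "even ((p - 1) div 2)") auto
  then show ?thesis
    using p(2) p2 unfolding cong_def by presburger
qed

lemma is_stormer_number_iff:
  assumes "odd p"
  shows "is_stormer_number p x \<longleftrightarrow> 1 < x \<and> 2 * x + 1 \<le> p \<and> p dvd x\<^sup>2 + 1"
proof -
  have "x \<le> (p - 1) div 2 \<longleftrightarrow> 2 * x + 1 \<le> p"
    using assms by (auto elim!: oddE)
  then show ?thesis
    unfolding is_stormer_number_def sqrt_minus_one_cong_iff_dvd by simp
qed

text \<open>Different primes \<open>p\<close> and \<open>q\<close> would give a divisor \<open>p * q \<ge> (2 * x + 1)\<^sup>2\<close> of \<open>x\<^sup>2 + 1\<close>.\<close>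

lemma large_prime_divisor_of_square_plus_one_unique:
  fixes p q x :: nat
  assumes "0 < x" and p: "prime p" "2 * x + 1 \<le> p" "p dvd x\<^sup>2 + 1"
    and q: "prime q" "2 * x + 1 \<le> q" "q dvd x\<^sup>2 + 1"
  shows "p = q"
proof (rule ccontr)
  assume "p \<noteq> q"
  then have "p * q dvd x\<^sup>2 + 1"
    using p q by (intro divides_mult) (auto simp: primes_coprime)
  then have "p * q \<le> x\<^sup>2 + 1" by (rule dvd_imp_le) simp
  moreover have "(2 * x + 1) * (2 * x + 1) \<le> p * q"
    using p(2) q(2) by (rule mult_le_mono)
  moreover have "x\<^sup>2 + 1 < (2 * x + 1) * (2 * x + 1)"
    using \<open>0 < x\<close> by (simp add: power2_eq_square algebra_simps)
  ultimately show False by linarith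
qed

text \<open>This identifies the primes of the given factorization with the odd prime divisors of \<open>n\<close>.\<close>

lemma odd_prime_divisor_in_factorization:
  fixes n r :: nat and P e :: "'a \<Rightarrow> nat"
  assumes "finite A" "\<And>j. j \<in> A \<Longrightarrow> prime (P j)" and n: "n = 2 ^ r * (\<Prod>j\<in>A. P j ^ e j)"
    and p: "prime p" "odd p" "p dvd n"
  obtains j where "j \<in> A" "p = P j"
proof -
  have "\<not> p dvd 2 ^ r"
    using p by (metis prime_dvd_power primes_dvd_imp_eq two_is_prime_nat even_numeral)
  then have "p dvd (\<Prod>j\<in>A. P j ^ e j)"
    using p n by (simp add: prime_dvd_mult_iff)
  then obtain j where "j \<in> A" "p dvd P j ^ e j"
    using \<open>finite A\<close> p(1) by (auto simp: prime_dvd_prod_iff)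
  with assms(2) p(1) that show thesis
    by (metis prime_dvd_power primes_dvd_imp_eq)
qed

theorem theorem2p3:
  fixes x0 m r :: nat and P e :: "nat \<Rightarrow> nat"
  assumes "0 < x0"
    and "1 \<le> m"
    and "\<And>j. j \<in> {1..m} \<Longrightarrow> prime (P j) \<and> odd (P j)"
    and "strict_mono_on {1..m} P"
    and "\<And>j. j \<in> {1..m} \<Longrightarrow> 0 < e j"
    and "x0\<^sup>2 + 1 = 2 ^ r * (\<Prod>j=1..m. P j ^ e j)"
  shows "((\<exists>p. prime p \<and> [p = 1] (mod 4) \<and> is_stormer_number p x0) \<longleftrightarrow> 2 * x0 + 1 \<le> P m)
    \<and> (2 * x0 + 1 \<le> P m \<longrightarrow>
        [P m = 1] (mod 4) \<and> is_stormer_number (P m) x0 \<and> stormer (P m) = x0 \<and>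
        (\<forall>p. prime p \<and> [p = 1] (mod 4) \<and> is_stormer_number p x0 \<longrightarrow> p = P m))
    \<and> (\<not> 2 * x0 + 1 \<le> P m \<longrightarrow>
        (\<forall>p. prime p \<and> [p = 1] (mod 4) \<longrightarrow> \<not> is_stormer_number p x0))"
proof -
  have m: "m \<in> {1..m}" using assms(2) by simp
  have Pm: "prime (P m)" "odd (P m)" using assms(3)[OF m] by auto
  have "P m dvd P m ^ e m" using assms(5)[OF m] by (simp add: dvd_power)
  also have "P m ^ e m dvd (\<Prod>j=1..m. P j ^ e j)"
    using m by (intro dvd_prodI) auto
  finally have Pm_dvd: "P m dvd x0\<^sup>2 + 1" using assms(6) by simp
  \<comment> \<open>The value \<open>x0 = 1\<close> is excluded by the presence of an odd prime divisor.\<close>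
  have "x0 \<noteq> 1"
  proof
    assume "x0 = 1"
    then have "P m dvd 2" using Pm_dvd by (simp add: numeral_2_eq_2)
    then have "P m = 2" using Pm(1) primes_dvd_imp_eq two_is_prime_nat by blast
    then show False using Pm(2) by simp
  qed
  then have x1: "1 < x0" using assms(1) by simp
  have Pm4: "[P m = 1] (mod 4)"
    using odd_prime_dvd_square_plus_one_cong_1_mod_4 Pm Pm_dvd by blast
  have criterion: "is_stormer_number (P m) x0 \<longleftrightarrow> 2 * x0 + 1 \<le> P m"
    using is_stormer_number_iff[OF Pm(2)] x1 Pm_dvd by simp
  have only_Pm: "p = P m \<and> 2 * x0 + 1 \<le> P m"
    if p: "prime p" "[p = 1] (mod 4)" "is_stormer_number p x0" for p
  proof -
    have "odd p" using p(2) unfolding cong_def by presburger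
    then have large: "2 * x0 + 1 \<le> p" "p dvd x0\<^sup>2 + 1"
      using p(3) by (simp_all add: is_stormer_number_iff)
    obtain j where j: "j \<in> {1..m}" "p = P j"
      using odd_prime_divisor_in_factorization[OF _ _ assms(6) p(1) \<open>odd p\<close> large(2)] assms(3)
      by blast
    have "P j \<le> P m"
      using strict_mono_on_leD[OF assms(4) j(1) m] j(1) by simp
    then have Pm_large: "2 * x0 + 1 \<le> P m" using large(1) j(2) by simp
    moreover have "p = P m"
      using large_prime_divisor_of_square_plus_one_unique assms(1) p(1) large Pm(1)
        Pm_large Pm_dvd by blast
    ultimately show ?thesis by simp
  qed
  have "stormer (P m) = x0" if "2 * x0 + 1 \<le> P m"
    using that criterion stormer_eq_iff[OF Pm(1) Pm4] by simp
  then show ?thesis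
    using only_Pm criterion Pm(1) Pm4 by blast
qed

end
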